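(* Let $S=(\mathbb{CP}^1,\Omega,\infty)$ be a stability theory with $\Omega_s=\Omega$ finite, $|\Omega_s|=r$. Consider the $D$-stratification of $S^{(n)}$, $n\ge1$. (1) $\bigcup_{i=1}^n(i,n-i)_S$ is the union of a general position arrangement of $r$ complex projective hyperplanes in $(\mathbb{CP}^1)^{(n)}\cong\mathbb{CP}^n$. (2) For $1\le q\le n$, $\bigcup_{q\le s\le n}(s,n-s)_S$ is the union of an arrangement of $\binom{r+q-1}{q}$ complex projective subspaces of dimension $n-q$. The intersection poset of this arrangement is the poset of all multisubsets of $\{1,\dots,r\}$ of cardinality no less than $q$ and no greater than $n$, where intersections of subspaces correspond to unions of multisubsets. The codimension of an intersection of subspaces equals the cardinality of the corresponding multisubset.
   Context: A stability theory is given by a semialgebraic set $\Omega\subseteq\mathbb{CP}^1$. If $\Omega$ is finite, it is closed, so the semistable stratum $\overline\Omega\setminus\Omega$ is empty and $\Omega_{un}=\mathbb{CP}^1\setminus\Omega$. $S^{(n)}=(\mathbb{CP}^1)^{(n)}=(\mathbb{CP}^1)^n/\Sigma_n$ is the set of multisets of $n$ points of $\mathbb{CP}^1$, identified with $\mathbb{CP}^n$, the projective space of nonzero complex binary forms of degree $n$, by sending a form to its multiset of roots. $(i,n-i)_S$ is the set of multisets with exactly $i$ points in $\Omega$ and $n-i$ points in $\mathbb{CP}^1\setminus\Omega$ (with multiplicity). A family of hyperplanes in $\mathbb{CP}^n$ is in general position if any $j\le n$ of them intersect in codimension $j$ and any $n+1$ of them have empty intersection. The intersection poset of an arrangement is the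 set of all non-empty intersections of non-empty subfamilies, ordered by reverse inclusion; multisubsets (functions $\{1,\dots,r\}\to\mathbb N$, the cardinality being the sum of the values) are ordered by inclusion (pointwise $\le$), and the union of multisubsets is the pointwise maximum.
   Formalization: The intersection poset in (2) is taken to be the multisubsets of cardinality between q and n with all multiplicities at most q, since the claim for all such multisubsets fails (r=1, n=2, q=1: one line, but two multisubsets). *)

theory Defs
  imports "HOL-Computational_Algebra.Computational_Algebra"
begin

definition proj_rel :: "complex \<times> complex \<Rightarrow> complex \<times> complex \<Rightarrow> bool" where
  "proj_rel u v \<longleftrightarrow> u \<noteq> (0, 0) \<and> v \<noteq> (0, 0) \<and> (\<exists>c. v = (c * fst u, c * snd u))"

lemma proj_rel_Pair:
  "proj_rel (a, b) (a', b') \<longleftrightarrow>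
    (a, b) \<noteq> (0, 0) \<and> (a', b') \<noteq> (0, 0) \<and> (\<exists>c. a' = c * a \<and> b' = c * b)"
  by (simp add: proj_rel_def)

lemma proj_rel_self: "u \<noteq> (0, 0) \<Longrightarrow> proj_rel u u"
  by (cases u) (simp only: proj_rel_Pair, metis mult_1)

lemma proj_rel_sym:
  assumes "proj_rel u v"
  shows "proj_rel v u"
proof -
  obtain a b a' b' where uv: "u = (a, b)" "v = (a', b')" by (cases u, cases v)
  with assms obtain c where nz: "(a, b) \<noteq> (0, 0)" "(a', b') \<noteq> (0, 0)" and c: "a' = c * a" "b' = c * b"
    unfolding uv proj_rel_Pair by blast
  then have "c \<noteq> 0" by force
  with c have "a = inverse c * a'" "b = inverse c * b'" by simp_all
  with nz show ?thesis unfolding uv proj_rel_Pair by blast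
qed

lemma proj_rel_trans:
  assumes "proj_rel u v" "proj_rel v w"
  shows "proj_rel u w"
proof -
  obtain a b a' b' a'' b'' where uvw: "u = (a, b)" "v = (a', b')" "w = (a'', b'')"
    by (cases u, cases v, cases w)
  obtain c where c: "a' = c * a" "b' = c * b" and nz: "(a, b) \<noteq> (0, 0)"
    using assms(1) unfolding uvw proj_rel_Pair by blast
  obtain d where d: "a'' = d * a'" "b'' = d * b'" and nz': "(a'', b'') \<noteq> (0, 0)"
    using assms(2) unfolding uvw proj_rel_Pair by blast
  from c d have "a'' = (d * c) * a" "b'' = (d * c) * b" by (simp_all add: mult.assoc)
  with nz nz' show ?thesis unfolding uvw proj_rel_Pair by blast
qed

lemma proj_rel_part_equivp: "part_equivp proj_rel"
proof (rule part_equivpI)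
  have "proj_rel (1, 0) (1, 0)" by (rule proj_rel_self) simp
  then show "\<exists>u. proj_rel u u" ..
  show "symp proj_rel" by (rule sympI) (rule proj_rel_sym)
  show "transp proj_rel" by (rule transpI) (rule proj_rel_trans)
qed

quotient_type cp1 = "complex \<times> complex" / partial: proj_rel
  by (rule proj_rel_part_equivp)

text \<open>
  A binary form of degree \<open>n\<close> in \<open>x, y\<close> is encoded by its coefficients: the polynomial \<open>F\<close> of
  degree at most \<open>n\<close> stands for the form whose coefficient at \<open>x\<^sup>i y\<^sup>n\<^sup>-\<^sup>i\<close> is \<open>coeff F i\<close>. Products of
  forms are products of polynomials (lemma \<open>form_eval_mult\<close>), and the linear form \<open>b x - a y\<close>
  is \<open>[:-a, b:]\<close>.
\<close>

definition forms :: "nat \<Rightarrow> complex poly set" where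
  "forms n = {F. degree F \<le> n}"

definition form_eval :: "nat \<Rightarrow> complex poly \<Rightarrow> complex \<Rightarrow> complex \<Rightarrow> complex" where
  "form_eval n F x y = (\<Sum>i\<le>n. coeff F i * x ^ i * y ^ (n - i))"

lemma form_eval_nz:
  assumes "F \<in> forms n" "y \<noteq> 0"
  shows "form_eval n F x y = y ^ n * poly F (x / y)"
proof -
  have "poly F (x / y) = (\<Sum>i\<le>n. coeff F i * (x / y) ^ i)"
    unfolding poly_altdef
    by (rule sum.mono_neutral_left) (use assms in \<open>auto simp: forms_def coeff_eq_0\<close>)
  then have "y ^ n * poly F (x / y) = (\<Sum>i\<le>n. y ^ n * (coeff F i * (x / y) ^ i))"
    by (simp add: sum_distrib_left)
  also have "\<dots> = form_eval n F x y"
    unfolding form_eval_def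
  proof (rule sum.cong[OF refl])
    fix i assume "i \<in> {..n}"
    then have "y ^ n = y ^ i * y ^ (n - i)" by (simp flip: power_add)
    with assms show "y ^ n * (coeff F i * (x / y) ^ i) = coeff F i * x ^ i * y ^ (n - i)"
      by (simp add: power_divide)
  qed
  finally show ?thesis by simp
qed

lemma form_eval_0:
  assumes "F \<in> forms n"
  shows "form_eval n F x 0 = coeff F n * x ^ n"
proof -
  have "form_eval n F x 0 = (\<Sum>i\<le>n. if i = n then coeff F i * x ^ i else 0)"
    unfolding form_eval_def by (rule sum.cong) auto
  then show ?thesis by simp
qed

lemma form_eval_mult:
  assumes "F \<in> forms m" "G \<in> forms n"
  shows "F * G \<in> forms (m + n)"
    and "form_eval (m + n) (F * G) x y = form_eval m F x y * form_eval n G x y"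
proof -
  show *: "F * G \<in> forms (m + n)"
    using assms degree_mult_le[of F G] by (auto simp: forms_def)
  show "form_eval (m + n) (F * G) x y = form_eval m F x y * form_eval n G x y"
  proof (cases "y = 0")
    case True
    have "coeff (F * G) (m + n) = coeff F m * coeff G n"
    proof (cases "degree F = m \<and> degree G = n")
      case True
      then show ?thesis using coeff_mult_degree_sum[of F G] by simp
    next
      case False
      then have "degree F < m \<or> degree G < n" using assms by (auto simp: forms_def)
      then have "coeff F m * coeff G n = 0" by (auto simp: coeff_eq_0)
      moreover have "degree (F * G) < m + n"
        using False assms degree_mult_le[of F G] by (auto simp: forms_def)
      ultimately show ?thesis by (simp add: coeff_eq_0)
    qed
    then show ?thesis using True assms * by (simp add: form_eval_0 power_add)
  next
    case False
    then show ?thesis using assms * by (simp add: form_eval_nz power_add)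
  qed
qed

lemma linear_form_scale:
  assumes "F = [:- (c * a), c * b:] ^ k * G" "G \<in> forms m"
  shows "\<exists>G\<in>forms m. F = [:- a, b:] ^ k * G"
proof
  have "[:- (c * a), c * b:] = smult c [:- a, b:]" by simp
  then have "F = smult (c ^ k) ([:- a, b:] ^ k) * G" using assms(1) by (simp only: smult_power)
  then show "F = [:- a, b:] ^ k * smult (c ^ k) G"
    by (simp only: mult_smult_left mult_smult_right)
  have "degree (smult (c ^ k) G) \<le> degree G" by (rule degree_smult_le)
  also have "\<dots> \<le> m" using assms(2) unfolding forms_def by (rule CollectD)
  finally show "smult (c ^ k) G \<in> forms m" unfolding forms_def by (rule CollectI)
qed

text \<open>
  Multiplicity of the point \<open>[a : b]\<close> as a root of the form \<open>F\<close> of degree \<open>n\<close>: the largest \<open>k\<close>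
  such that \<open>F\<close> is \<open>(b x - a y)\<^sup>k\<close> times a form of degree \<open>n - k\<close>. The bound on the cofactor is what
  gives \<open>[1 : 0]\<close> the multiplicity \<open>n - degree F\<close>.
\<close>

lift_definition root_mult :: "nat \<Rightarrow> complex poly \<Rightarrow> cp1 \<Rightarrow> nat" is
  "\<lambda>n F (a, b). Max {k. k \<le> n \<and> (\<exists>G\<in>forms (n - k). F = [:- a, b:] ^ k * G)}"
proof -
  fix n F u v
  assume r: "proj_rel u v"
  obtain a b a' b' where uv: "u = (a, b)" "v = (a', b')" by (cases u, cases v)
  from r obtain c where c: "a' = c * a" "b' = c * b" unfolding uv proj_rel_Pair by blast
  from proj_rel_sym[OF r] obtain d where d: "a = d * a'" "b = d * b'"
    unfolding uv proj_rel_Pair by blast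
  have "(\<exists>G\<in>forms (n - k). F = [:- a, b:] ^ k * G) \<longleftrightarrow>
        (\<exists>G\<in>forms (n - k). F = [:- a', b':] ^ k * G)" for k
    using linear_form_scale[of F c a b k _ "n - k", folded c]
      linear_form_scale[of F d a' b' k _ "n - k", folded d] by blast
  then show "(case u of (a, b) \<Rightarrow> Max {k. k \<le> n \<and> (\<exists>G\<in>forms (n - k). F = [:- a, b:] ^ k * G)}) =
      (case v of (a, b) \<Rightarrow> Max {k. k \<le> n \<and> (\<exists>G\<in>forms (n - k). F = [:- a, b:] ^ k * G)})"
    unfolding uv prod.case by (simp only:)
qed

text \<open>Meaningful for nonzero \<open>F \<in> forms n\<close>: see \<open>count_root_mset\<close> and \<open>size_root_mset\<close>.\<close>

definition root_mset :: "nat \<Rightarrow> complex poly \<Rightarrow> cp1 multiset" where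
  "root_mset n F = Abs_multiset (root_mult n F)"

global_interpretation cpoly: vector_space "smult :: complex \<Rightarrow> complex poly \<Rightarrow> complex poly"
  by unfold_locales (simp_all add: smult_add_right smult_add_left)

definition projectivization :: "complex poly set \<Rightarrow> complex poly set set" where
  "projectivization W = {cpoly.span {F} |F. F \<in> W \<and> F \<noteq> 0}"

definition CP :: "nat \<Rightarrow> complex poly set set" where
  "CP n = projectivization (forms n)"

definition sym_power :: "nat \<Rightarrow> cp1 multiset set" where
  "sym_power n = {M. size M = n}"

text \<open>
  The identification of \<open>CP n\<close> with \<open>sym_power n\<close> (see \<open>point_roots_span\<close> and \<open>bij_betw_point_roots\<close>).
\<close>

definition point_roots :: "nat \<Rightarrow> complex poly set \<Rightarrow> cp1 multiset" where
  "point_roots n P = root_mset n (SOME F. F \<in> P \<and> F \<noteq> 0)"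

text \<open>
  \<open>d\<close> is the projective dimension, so the codimension in \<open>CP n\<close> is \<open>n - d\<close>; the empty set is not
  a \<open>proj_subspace\<close>.
\<close>

definition proj_subspace :: "nat \<Rightarrow> nat \<Rightarrow> complex poly set set \<Rightarrow> bool" where
  "proj_subspace n d X \<longleftrightarrow>
    (\<exists>W. cpoly.subspace W \<and> W \<subseteq> forms n \<and> cpoly.dim W = d + 1 \<and> X = projectivization W)"

definition proj_hyperplane :: "nat \<Rightarrow> complex poly set set \<Rightarrow> bool" where
  "proj_hyperplane n X \<longleftrightarrow> proj_subspace n (n - 1) X"

definition general_position :: "nat \<Rightarrow> complex poly set set set \<Rightarrow> bool" where
  "general_position n \<H> \<longleftrightarrow>
    (\<forall>\<F>\<subseteq>\<H>. finite \<F> \<longrightarrow>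
      (1 \<le> card \<F> \<and> card \<F> \<le> n \<longrightarrow> proj_subspace n (n - card \<F>) (\<Inter>\<F>)) \<and>
      (card \<F> = n + 1 \<longrightarrow> \<Inter>\<F> = {}))"

definition intersection_poset :: "'a set set \<Rightarrow> 'a set set" where
  "intersection_poset \<A> = {\<Inter>\<F> |\<F>. \<F> \<subseteq> \<A> \<and> \<F> \<noteq> {} \<and> \<Inter>\<F> \<noteq> {}}"

definition stratum :: "cp1 set \<Rightarrow> nat \<Rightarrow> nat \<Rightarrow> cp1 multiset set" where
  "stratum \<Omega> i j = {M. size (filter_mset (\<lambda>p. p \<in> \<Omega>) M) = i \<and> size (filter_mset (\<lambda>p. p \<notin> \<Omega>) M) = j}"

text \<open>
  Inclusion and pointwise maximum are \<open>\<subseteq>#\<close> and \<open>\<union>#\<close>. An intersection of subspaces indexed by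
  multisubsets of size \<open>q\<close> is indexed by a union of such multisubsets. A multisubset of size at
  least \<open>q\<close> is a nonempty union of multisubsets of size \<open>q\<close> iff all its multiplicities are at most
  \<open>q\<close>: for \<open>q = 1\<close>, the multiset \<open>{#1, 1#}\<close> is not a union of singletons.
\<close>

definition multisubsets :: "nat \<Rightarrow> nat \<Rightarrow> nat \<Rightarrow> nat multiset set" where
  "multisubsets r q n = {M. set_mset M \<subseteq> {1..r} \<and> q \<le> size M \<and> size M \<le> n}"

definition fin_pt :: "complex \<Rightarrow> cp1" where
  "fin_pt z = abs_cp1 (z, 1)"

definition inf_pt :: cp1 where
  "inf_pt = abs_cp1 (1, 0)"

lemma cp1_cases: obtains z where "p = fin_pt z" | "p = inf_pt"
proof -
  obtain u where u: "proj_rel u u" "p = abs_cp1 u"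
    using Quotient_cp1 by (metis Quotient_abs_rep Quotient_rep_reflp)
  obtain a b where ab: "u = (a, b)" by (cases u)
  show ?thesis
  proof (cases "b = 0")
    case True
    then have "proj_rel u (1, 0)" using u ab by (auto simp: proj_rel_def intro!: exI[of _ "inverse a"])
    then have "p = inf_pt" unfolding inf_pt_def u(2) by (metis Quotient_cp1 Quotient_rel_abs)
    then show ?thesis using that by blast
  next
    case False
    then have "proj_rel u (a / b, 1)"
      using u ab by (auto simp: proj_rel_def field_simps intro!: exI[of _ "inverse b"])
    then have "p = fin_pt (a / b)" unfolding fin_pt_def u(2) by (metis Quotient_cp1 Quotient_rel_abs)
    then show ?thesis using that by blast
  qed
qed

lemma fin_pt_eq_iff [simp]: "fin_pt z = fin_pt w \<longleftrightarrow> z = w"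
proof
  assume "fin_pt z = fin_pt w"
  then have "proj_rel (z, 1) (w, 1)"
    unfolding fin_pt_def
    using Quotient_rel[OF Quotient_cp1, of "(z, 1)" "(w, 1)"] by (simp add: proj_rel_self)
  then show "z = w" by (auto simp: proj_rel_def)
qed simp

lemma fin_pt_neq_inf_pt [simp]: "fin_pt z \<noteq> inf_pt" "inf_pt \<noteq> fin_pt z"
proof -
  have "\<not> proj_rel (z, 1) (1, 0)" by (auto simp: proj_rel_def)
  then show "fin_pt z \<noteq> inf_pt"
    unfolding fin_pt_def inf_pt_def
    using Quotient_rel[OF Quotient_cp1, of "(z, 1)" "(1, 0)"] by (simp add: proj_rel_self)
  then show "inf_pt \<noteq> fin_pt z" by metis
qed

lemma root_mult_fin_pt_Max:
  "root_mult n F (fin_pt z) = Max {k. k \<le> n \<and> (\<exists>G\<in>forms (n - k). F = [:-z, 1:] ^ k * G)}"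
proof -
  have "proj_rel (z, 1) (z, 1)" by (rule proj_rel_self) simp
  then show ?thesis unfolding fin_pt_def by (subst root_mult.abs_eq) (simp_all only: prod.case)
qed

lemma root_mult_inf_pt_Max:
  "root_mult n F inf_pt = Max {k. k \<le> n \<and> (\<exists>G\<in>forms (n - k). F = [:-1, 0:] ^ k * G)}"
proof -
  have "proj_rel (1, 0) (1, 0)" by (rule proj_rel_self) simp
  then show ?thesis unfolding inf_pt_def by (subst root_mult.abs_eq) (simp_all only: prod.case)
qed

lemma root_mult_fin_pt:
  assumes "F \<in> forms n" "F \<noteq> 0"
  shows "root_mult n F (fin_pt z) = order z F"
proof -
  have deg: "degree F \<le> n" using assms by (simp add: forms_def)
  have "{k. k \<le> n \<and> (\<exists>G\<in>forms (n - k). F = [:-z, 1:] ^ k * G)} = {..order z F}" (is "?A = _")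
  proof (intro equalityI subsetI)
    fix k assume "k \<in> ?A"
    then have "[:-z, 1:] ^ k dvd F" by auto
    then show "k \<in> {..order z F}" using assms by (simp add: order_divides)
  next
    fix k assume "k \<in> {..order z F}"
    then have k: "k \<le> order z F" by simp
    have "[:-z, 1:] ^ k dvd F" using k by (simp add: order_divides)
    then obtain G where G: "F = [:-z, 1:] ^ k * G" by auto
    with assms have "G \<noteq> 0" by auto
    with G have "degree F = k + degree G" by (simp add: degree_mult_eq degree_power_eq)
    then show "k \<in> ?A" using G deg by (auto simp: forms_def)
  qed
  moreover have "Max {..order z F} = order z F" by (intro Max_eqI) auto
  ultimately show ?thesis by (simp only: root_mult_fin_pt_Max)
qed

lemma root_mult_inf_pt:
  assumes "F \<in> forms n" "F \<noteq> 0"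
  shows "root_mult n F inf_pt = n - degree F"
proof -
  have deg: "degree F \<le> n" using assms by (simp add: forms_def)
  have pow: "[:-1, 0:] ^ k * G = smult ((- 1) ^ k) G" for k and G :: "complex poly"
    by (induction k) simp_all
  have "{k. k \<le> n \<and> (\<exists>G\<in>forms (n - k). F = [:-1, 0:] ^ k * G)} = {..n - degree F}"
  proof (intro equalityI subsetI)
    fix k assume "k \<in> {k. k \<le> n \<and> (\<exists>G\<in>forms (n - k). F = [:-1, 0:] ^ k * G)}"
    then obtain G where "k \<le> n" "G \<in> forms (n - k)" and F: "F = smult ((- 1) ^ k) G"
      unfolding pow by blast
    then have "degree F \<le> n - k" by (simp add: forms_def)
    then show "k \<in> {..n - degree F}" using \<open>k \<le> n\<close> by simp
  next
    fix k assume "k \<in> {..n - degree F}"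
    then have k: "k \<le> n - degree F" by simp
    have "(- 1) ^ k * (- 1) ^ k = (1::complex)" by (simp only: power_mult_distrib[symmetric] square_eq_1_iff minus_mult_minus mult_1 power_one)
    then have "F = [:-1, 0:] ^ k * smult ((- 1) ^ k) F" unfolding pow by simp
    moreover have "smult ((- 1) ^ k) F \<in> forms (n - k)" using k deg by (simp add: forms_def)
    moreover have "k \<le> n" using k by simp
    ultimately show "k \<in> {k. k \<le> n \<and> (\<exists>G\<in>forms (n - k). F = [:-1, 0:] ^ k * G)}"
      by blast
  qed
  moreover have "Max {..n - degree F} = n - degree F" by (intro Max_eqI) auto
  ultimately show ?thesis by (simp only: root_mult_inf_pt_Max)
qed

lemma count_image_fin_pt:
  "count (image_mset fin_pt A) (fin_pt z) = count A z" "count (image_mset fin_pt A) inf_pt = 0"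
proof -
  show "count (image_mset fin_pt A) (fin_pt z) = count A z"
    by (induction A) simp_all
  show "count (image_mset fin_pt A) inf_pt = 0"
    by (simp add: count_eq_zero_iff image_iff)
qed

lemma root_mult_eq_count:
  assumes "F \<in> forms n" "F \<noteq> 0"
  shows "root_mult n F = count (image_mset fin_pt (proots F) + replicate_mset (n - degree F) inf_pt)"
proof
  fix p
  show "root_mult n F p = count (image_mset fin_pt (proots F) + replicate_mset (n - degree F) inf_pt) p"
    by (cases p rule: cp1_cases)
       (use assms in \<open>simp_all add: root_mult_fin_pt root_mult_inf_pt count_image_fin_pt\<close>)
qed

lemma root_mset_eq:
  assumes "F \<in> forms n" "F \<noteq> 0"
  shows "root_mset n F = image_mset fin_pt (proots F) + replicate_mset (n - degree F) inf_pt"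
  unfolding root_mset_def root_mult_eq_count[OF assms] by (rule count_inverse)

lemma count_root_mset:
  assumes "F \<in> forms n" "F \<noteq> 0"
  shows "count (root_mset n F) p = root_mult n F p"
  using root_mset_eq[OF assms] root_mult_eq_count[OF assms] by simp

lemma size_root_mset:
  assumes "F \<in> forms n" "F \<noteq> 0"
  shows "size (root_mset n F) = n"
  using assms by (simp add: root_mset_eq size_proots_complex forms_def)

lemma root_mset_smult:
  assumes "F \<in> forms n" "F \<noteq> 0" "c \<noteq> 0"
  shows "root_mset n (smult c F) = root_mset n F"
proof -
  have "smult c F \<in> forms n" using assms by (simp add: forms_def)
  then show ?thesis using assms by (simp add: root_mset_eq)
qed

lemma span_singleton: "cpoly.span {F} = range (\<lambda>c. smult c F)"
  by (rule cpoly.span_singleton)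

lemma point_roots_span:
  assumes "F \<in> forms n" "F \<noteq> 0"
  shows "point_roots n (cpoly.span {F}) = root_mset n F"
proof -
  have "\<exists>G. G \<in> cpoly.span {F} \<and> G \<noteq> 0" using assms(2) cpoly.span_base by blast
  then have "(SOME G. G \<in> cpoly.span {F} \<and> G \<noteq> 0) \<in> cpoly.span {F} \<and>
      (SOME G. G \<in> cpoly.span {F} \<and> G \<noteq> 0) \<noteq> 0" (is "?G \<in> _ \<and> _") by (rule someI_ex)
  then obtain c where c: "?G = smult c F" "c \<noteq> 0" by (auto simp: span_singleton)
  then show ?thesis unfolding point_roots_def using root_mset_smult[OF assms c(2)] by simp
qed

lemma root_mset_inj:
  assumes "F \<in> forms n" "F \<noteq> 0" "G \<in> forms n" "G \<noteq> 0" "root_mset n F = root_mset n G"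
  shows "cpoly.span {F} = cpoly.span {G}"
proof -
  have "order z F = order z G" for z
    using assms by (metis count_root_mset root_mult_fin_pt)
  then have pr: "proots F = proots G" using assms by (intro multiset_eqI) simp
  define P where "P = (\<Prod>x\<in>#proots F. [:-x, 1:])"
  have F: "F = smult (lead_coeff F) P"
    unfolding P_def by (rule complex_poly_decompose_multiset[symmetric])
  have G: "G = smult (lead_coeff G) P"
    unfolding P_def pr by (rule complex_poly_decompose_multiset[symmetric])
  have "cpoly.span {smult c P} = cpoly.span {P}" if "c \<noteq> 0" for c
    unfolding span_singleton
  proof safe
    fix d
    show "smult d (smult c P) \<in> range (\<lambda>c. smult c P)" by auto
    show "smult d P \<in> range (\<lambda>d. smult d (smult c P))"
      using that by (intro range_eqI[of _ _ "d / c"]) simp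
  qed
  then show ?thesis using F G assms(2,4) by (metis leading_coeff_0_iff)
qed

lemma root_mset_surj:
  assumes "size M = n"
  obtains F where "F \<in> forms n" "F \<noteq> 0" "root_mset n F = M"
proof -
  have "\<exists>A k. M = image_mset fin_pt A + replicate_mset k inf_pt"
  proof (induction M)
    case empty
    then show ?case by (intro exI[of _ "{#}"] exI[of _ 0]) simp
  next
    case (add p M)
    then obtain A k where M: "M = image_mset fin_pt A + replicate_mset k inf_pt" by blast
    show ?case
    proof (cases p rule: cp1_cases)
      case (1 z)
      then show ?thesis by (intro exI[of _ "add_mset z A"] exI[of _ k]) (simp add: M)
    next
      case 2
      then show ?thesis by (intro exI[of _ A] exI[of _ "Suc k"]) (simp add: M)
    qed
  qed
  then obtain A k where M: "M = image_mset fin_pt A + replicate_mset k inf_pt" by blast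
  define F where "F = (\<Prod>x\<in>#A. [:-x, 1::complex:])"
  have nz: "F \<noteq> 0" by (auto simp: F_def prod_mset_zero_iff)
  have "proots (\<Prod>x\<in>#A. [:-x, 1::complex:]) = A"
  proof (induction A)
    case (add x A)
    have "(\<Prod>x\<in>#A. [:-x, 1::complex:]) \<noteq> 0"
      by (auto simp: prod_mset_zero_iff)
    moreover have "[:-x, 1:] \<noteq> 0" by simp
    ultimately have "proots ([:-x, 1:] * (\<Prod>x\<in>#A. [:-x, 1::complex:])) = add_mset x A"
      using proots_mult[of "[:-x, 1:]" "\<Prod>x\<in>#A. [:-x, 1::complex:]"] add.IH
      by (simp del: mult_pCons_left)
    then show ?case by (simp only: image_mset_add_mset prod_mset.add_mset)
  qed simp
  then have "proots F = A" by (simp only: F_def)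
  moreover from this have deg: "degree F = size A" by (metis size_proots_complex)
  moreover have sz: "size A + k = n" using assms by (simp add: M)
  moreover have "F \<in> forms n" using deg sz by (simp add: forms_def)
  ultimately have "root_mset n F = M" using nz root_mset_eq[of F n] M by auto
  with \<open>F \<in> forms n\<close> nz show ?thesis by (rule that)
qed

lemma bij_betw_point_roots: "bij_betw (point_roots n) (CP n) (sym_power n)"
  unfolding bij_betw_def
proof
  show "inj_on (point_roots n) (CP n)"
  proof (rule inj_onI)
    fix P Q assume "P \<in> CP n" "Q \<in> CP n" and eq: "point_roots n P = point_roots n Q"
    then obtain F G where F: "F \<in> forms n" "F \<noteq> 0" "P = cpoly.span {F}"
        and G: "G \<in> forms n" "G \<noteq> 0" "Q = cpoly.span {G}"
      unfolding CP_def projectivization_def by blast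
    with eq have "root_mset n F = root_mset n G" by (simp add: point_roots_span)
    with F G show "P = Q" using root_mset_inj by blast
  qed
  show "point_roots n ` CP n = sym_power n"
  proof (intro equalityI subsetI)
    fix M assume "M \<in> point_roots n ` CP n"
    then show "M \<in> sym_power n"
      by (auto simp: CP_def projectivization_def point_roots_span sym_power_def size_root_mset)
  next
    fix M assume "M \<in> sym_power n"
    then have "size M = n" by (simp add: sym_power_def)
    then obtain F where F: "F \<in> forms n" "F \<noteq> 0" "root_mset n F = M" by (rule root_mset_surj)
    then have "M = point_roots n (cpoly.span {F})" by (simp add: point_roots_span)
    moreover have "cpoly.span {F} \<in> CP n" using F by (auto simp: CP_def projectivization_def)
    ultimately show "M \<in> point_roots n ` CP n" by blast
  qed
qed

end

theory Submission
  imports Defs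
begin

text \<open>
  Roots of binary forms are multiplicative and determine a form up to a scalar. Hence a form of
  degree \<open>n\<close> has a given multiset \<open>A\<close> among its roots exactly when it is a multiple of the form \<open>E\<close>
  of degree \<open>size A\<close> with roots \<open>A\<close> (\<open>root_superset_iff_form_multiple\<close>). Multiplication by \<open>E\<close> is
  linear and injective, so the points of \<open>CP n\<close> whose roots contain \<open>A\<close> form a projective subspace
  of codimension \<open>size A\<close> (\<open>proj_subspace_root_locus\<close>), called \<open>root_locus n A\<close> below.

  Everything else is combinatorics of multisets. Intersecting two such loci takes the union of the
  multisets; a locus is empty iff its multiset has more than \<open>n\<close> elements; and inclusion of nonempty
  loci reverses inclusion of multisets, since there is always a multiset of roots that extends a
  given one without using a chosen point. A multiset of \<open>n\<close> points has at least \<open>q\<close> elements in \<open>\<Omega>\<close>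
  iff it contains a multiset of size \<open>q\<close> over \<open>\<Omega>\<close>, so the loci of these multisets are the arrangement
  sought (\<open>Union_stratum\<close>), and there are \<open>(r + q - 1) choose q\<close> of them. For \<open>q = 1\<close> they are the
  hyperplanes of forms vanishing at one point of \<open>\<Omega>\<close>, which are in general position because \<open>j\<close>
  distinct points form a multiset of size \<open>j\<close>. Nonempty intersections are the loci of the unions of
  multisets of size \<open>q\<close>, which are the multisets of size between \<open>q\<close> and \<open>n\<close> with multiplicities at
  most \<open>q\<close> (\<open>intersection_poset_root_locus\<close>).
\<close>

section \<open>Multiplicativity of roots\<close>

lemma root_mset_mult:
  assumes F: "F \<in> forms m" "F \<noteq> 0" and G: "G \<in> forms n" "G \<noteq> 0"
  shows "root_mset (m + n) (F * G) = root_mset m F + root_mset n G"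
proof -
  have FG: "F * G \<in> forms (m + n)" "F * G \<noteq> 0"
    using form_eval_mult(1) F G by auto
  \<comment> \<open>The multiplicity at infinity is the degree defect, which is additive.\<close>
  have "(m + n) - degree (F * G) = (m - degree F) + (n - degree G)"
    using F G by (simp add: degree_mult_eq forms_def)
  then have "replicate_mset (m + n - degree (F * G)) inf_pt =
      replicate_mset (m - degree F) inf_pt + replicate_mset (n - degree G) inf_pt"
    by (simp add: multiset_eq_iff)
  then show ?thesis
    using F G FG by (simp add: root_mset_eq proots_mult)
qed

text \<open>
  The roots of \<open>F\<close> left over after removing those of \<open>E\<close> are the roots of some form \<open>G\<close>. Then \<open>E * G\<close>
  and \<open>F\<close> have the same roots, hence are proportional. The right-hand side is linear in \<open>F\<close>.
\<close>

lemma root_superset_iff_form_multiple: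
  assumes "E \<in> forms m" "E \<noteq> 0" and "F \<in> forms (m + d)" "F \<noteq> 0"
  shows "root_mset m E \<subseteq># root_mset (m + d) F \<longleftrightarrow> (\<exists>G\<in>forms d. F = E * G)"
proof
  assume "root_mset m E \<subseteq># root_mset (m + d) F"
  then obtain B where B: "root_mset (m + d) F = root_mset m E + B"
    by (auto simp: subset_mset.le_iff_add)
  then have "size B = d"
    using assms by (metis size_root_mset size_union add_left_cancel)
  then obtain G where G: "G \<in> forms d" "G \<noteq> 0" "root_mset d G = B"
    by (rule root_mset_surj)
  have EG: "E * G \<in> forms (m + d)" "E * G \<noteq> 0"
    using form_eval_mult(1) assms(1,2) G by auto
  have "root_mset (m + d) F = root_mset (m + d) (E * G)"
    using B G assms(1,2) by (simp add: root_mset_mult)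
  with assms EG have "cpoly.span {F} = cpoly.span {E * G}"
    using root_mset_inj by blast
  then obtain c where c: "F = smult c (E * G)"
    using cpoly.span_base[of F "{F}"] by (auto simp: span_singleton)
  have "smult c G \<in> forms d"
    using G(1) degree_smult_le[of c G] by (simp add: forms_def)
  with c show "\<exists>G\<in>forms d. F = E * G"
    by (intro bexI[of _ "smult c G"]) simp_all
next
  assume "\<exists>G\<in>forms d. F = E * G"
  then show "root_mset m E \<subseteq># root_mset (m + d) F"
    using assms by (auto simp: root_mset_mult)
qed

section \<open>The space of forms\<close>

lemma forms_eq_span_monom: "forms m = cpoly.span ((\<lambda>i. monom 1 i) ` {..m})"
proof (intro equalityI subsetI)
  fix F assume "F \<in> forms m"
  then have "F = (\<Sum>i\<le>m. monom (coeff F i) i)"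
    by (simp add: forms_def poly_as_sum_of_monoms')
  also have "\<dots> = (\<Sum>i\<le>m. smult (coeff F i) (monom 1 i))"
    by (simp add: smult_monom)
  also have "\<dots> \<in> cpoly.span ((\<lambda>i. monom 1 i) ` {..m})"
    by (intro cpoly.span_sum cpoly.span_scale cpoly.span_base) auto
  finally show "F \<in> cpoly.span ((\<lambda>i. monom 1 i) ` {..m})" .
next
  have "cpoly.subspace (forms m)"
    by (auto simp: cpoly.subspace_def forms_def intro: degree_add_le order_trans[OF degree_smult_le])
  moreover have "(\<lambda>i. monom 1 i) ` {..m} \<subseteq> forms m"
    by (auto simp: forms_def degree_monom_eq)
  ultimately show "F \<in> forms m" if "F \<in> cpoly.span ((\<lambda>i. monom 1 i) ` {..m})" for F
    using cpoly.span_minimal that by blast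
qed

lemma independent_monom: "cpoly.independent ((\<lambda>i. monom (1::complex) i) ` {..m})"
proof (rule cpoly.independent_if_scalars_zero)
  fix c :: "complex poly \<Rightarrow> complex" and F :: "complex poly"
  assume 0: "(\<Sum>G\<in>(\<lambda>i. monom 1 i) ` {..m}. smult (c G) G) = 0"
    and "F \<in> (\<lambda>i. monom 1 i) ` {..m}"
  then obtain j where j: "j \<le> m" "F = monom 1 j" by blast
  have "inj_on (\<lambda>i. monom (1::complex) i) {..m}"
    by (auto intro: inj_onI simp: monom_eq_iff')
  then have "(\<Sum>i\<le>m. smult (c (monom 1 i)) (monom 1 i)) = 0"
    using 0 by (simp add: sum.reindex)
  then have "coeff (\<Sum>i\<le>m. smult (c (monom 1 i)) (monom 1 i)) j = 0"
    by simp
  then show "c F = 0"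
    using j by (simp add: coeff_sum if_distrib cong: if_cong)
qed simp

text \<open>Multiplication by \<open>E\<close> maps the monomial basis of \<open>forms d\<close> injectively to a basis of the image.\<close>

lemma dim_form_multiples:
  assumes "E \<noteq> 0"
  shows "cpoly.subspace ((*) E ` forms d)" and "cpoly.dim ((*) E ` forms d) = d + 1"
proof -
  interpret mult: module_hom smult smult "(*) E"
    by unfold_locales (simp_all add: algebra_simps)
  let ?B = "(\<lambda>i. monom (1::complex) i) ` {..d}"
  have span: "(*) E ` forms d = cpoly.span ((*) E ` ?B)"
    by (simp add: forms_eq_span_monom mult.span_image)
  show "cpoly.subspace ((*) E ` forms d)"
    by (simp add: span)
  have inj: "inj ((*) E)"
    using assms by (simp add: inj_on_def)
  have "cpoly.independent ((*) E ` ?B)"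
    using independent_monom inj by (rule mult.independent_inj_image)
  then have "cpoly.dim ((*) E ` forms d) = card ((*) E ` ?B)"
    unfolding span by (rule cpoly.dim_span_eq_card_independent)
  also have "\<dots> = card ?B"
    using inj by (metis card_image inj_on_subset subset_UNIV)
  also have "\<dots> = card {..d}"
    by (rule card_image) (auto intro: inj_onI simp: monom_eq_iff')
  finally show "cpoly.dim ((*) E ` forms d) = d + 1"
    by simp
qed

section \<open>Loci of prescribed roots\<close>

definition root_locus :: "nat \<Rightarrow> cp1 multiset \<Rightarrow> complex poly set set" where
  "root_locus n A = {P \<in> CP n. A \<subseteq># point_roots n P}"

lemma point_roots_root_locus: "point_roots n ` root_locus n A = {R. size R = n \<and> A \<subseteq># R}"
proof (intro equalityI subsetI)
  fix R assume "R \<in> {R. size R = n \<and> A \<subseteq># R}"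
  moreover from this obtain P where "P \<in> CP n" "R = point_roots n P"
    using bij_betw_imp_surj_on[OF bij_betw_point_roots, of n] by (auto simp: sym_power_def)
  ultimately show "R \<in> point_roots n ` root_locus n A"
    by (auto simp: root_locus_def)
qed (use bij_betw_imp_surj_on[OF bij_betw_point_roots, of n] in
    \<open>auto simp: root_locus_def sym_power_def\<close>)

lemma proj_subspace_root_locus:
  assumes "size A \<le> n"
  shows "proj_subspace n (n - size A) (root_locus n A)"
proof -
  define m d where "m = size A" and "d = n - size A"
  have n: "n = m + d"
    using assms by (simp add: m_def d_def)
  obtain E where E: "E \<in> forms m" "E \<noteq> 0" and roots: "root_mset m E = A"
    using root_mset_surj[of A m] m_def by blast
  have sub: "(*) E ` forms d \<subseteq> forms n"
    using E form_eval_mult(1) n by auto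
  have iff: "F \<in> (*) E ` forms d \<longleftrightarrow> A \<subseteq># root_mset n F" if "F \<in> forms n" "F \<noteq> 0" for F
    using root_superset_iff_form_multiple[of E m F d] E that roots n by auto
  have "root_locus n A = projectivization ((*) E ` forms d)"
  proof (intro equalityI subsetI)
    fix P assume "P \<in> root_locus n A"
    then obtain F where F: "F \<in> forms n" "F \<noteq> 0" "P = cpoly.span {F}" "A \<subseteq># point_roots n P"
      by (auto simp: root_locus_def CP_def projectivization_def)
    then show "P \<in> projectivization ((*) E ` forms d)"
      using iff unfolding projectivization_def by (auto simp: point_roots_span)
  next
    fix P assume "P \<in> projectivization ((*) E ` forms d)"
    then obtain F where F: "F \<in> (*) E ` forms d" "F \<noteq> 0" "P = cpoly.span {F}"
      unfolding projectivization_def by blast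
    then have "F \<in> forms n"
      using sub by blast
    with F show "P \<in> root_locus n A"
      using iff[of F] unfolding root_locus_def CP_def projectivization_def
      by (auto simp: point_roots_span)
  qed
  then show ?thesis
    unfolding proj_subspace_def using dim_form_multiples[OF E(2)] sub d_def by blast
qed

lemma root_locus_Int: "root_locus n A \<inter> root_locus n B = root_locus n (A \<union># B)"
  by (auto simp: root_locus_def)

text \<open>A multiset of size at most \<open>n\<close> can be filled up to a multiset of \<open>n\<close> roots.\<close>

lemma root_locus_empty_iff: "root_locus n A = {} \<longleftrightarrow> n < size A"
proof -
  have "(\<exists>R. size R = n \<and> A \<subseteq># R) \<longleftrightarrow> size A \<le> n"
  proof
    assume "size A \<le> n"
    then have "size (A + replicate_mset (n - size A) inf_pt) = n"
      by simp
    then show "\<exists>R. size R = n \<and> A \<subseteq># R"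
      by (metis mset_subset_eq_add_left)
  qed (auto dest: size_mset_mono)
  then show ?thesis
    using point_roots_root_locus[of n A] by (auto simp: not_le[symmetric])
qed

text \<open>
  If \<open>B\<close> has more copies of \<open>p\<close> than \<open>A\<close>, fill \<open>A\<close> up to \<open>n\<close> roots with copies of another point: this
  form lies in the locus of \<open>A\<close> but not in that of \<open>B\<close>. The bound on the size of \<open>A\<close> excludes the
  empty locus, which is contained in every other.
\<close>

lemma root_locus_subset_iff:
  assumes "size A \<le> n"
  shows "root_locus n A \<subseteq> root_locus n B \<longleftrightarrow> B \<subseteq># A"
proof
  assume sub: "root_locus n A \<subseteq> root_locus n B"
  show "B \<subseteq># A"
  proof (rule ccontr)
    assume "\<not> B \<subseteq># A"
    then obtain p where p: "count A p < count B p"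
      by (auto simp: subseteq_mset_def not_le)
    obtain p' where p': "p' \<noteq> p"
      using fin_pt_neq_inf_pt by metis
    let ?R = "A + replicate_mset (n - size A) p'"
    have "?R \<in> point_roots n ` root_locus n A"
      using assms by (simp add: point_roots_root_locus)
    then have "?R \<in> point_roots n ` root_locus n B"
      using sub by blast
    then have "count B p \<le> count ?R p"
      by (simp add: point_roots_root_locus subseteq_mset_def)
    then show False
      using p p' by simp
  qed
qed (auto simp: root_locus_def)

lemma Inter_root_locus:
  assumes "\<A> \<noteq> {}"
  shows "\<Inter> (root_locus n ` \<A>) = {P \<in> CP n. \<forall>A\<in>\<A>. A \<subseteq># point_roots n P}"
  using assms by (auto simp: root_locus_def)

section \<open>The arrangement of a finite set of points\<close>

lemma multiset_between:
  assumes "A \<subseteq># B" "size A \<le> q" "q \<le> size B"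
  obtains C where "A \<subseteq># C" "C \<subseteq># B" "size C = q"
proof -
  obtain D where D: "B = A + D"
    using assms(1) by (auto simp: subset_mset.le_iff_add)
  obtain xs where xs: "mset xs = D"
    using ex_mset by blast
  let ?T = "mset (take (q - size A) xs)"
  have "?T \<subseteq># D"
    unfolding xs[symmetric] by (metis append_take_drop_id mset_append mset_subset_eq_add_left)
  moreover have "size xs = size B - size A"
    by (simp add: D flip: xs)
  ultimately show ?thesis
    using assms(2,3) by (intro that[of "A + ?T"]) (auto simp: D)
qed

text \<open>
  As no multiplicity exceeds \<open>q\<close>, all copies of a point \<open>p\<close> in \<open>A\<close> fit into a single submultiset of
  size \<open>q\<close>. So \<open>A\<close> is the union of its submultisets of size \<open>q\<close>, and an upper bound of these contains \<open>A\<close>.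
\<close>

lemma submultisets_cover:
  assumes "\<And>p. count A p \<le> q" "q \<le> size A"
    and "\<And>C. C \<subseteq># A \<Longrightarrow> size C = q \<Longrightarrow> C \<subseteq># R"
  shows "A \<subseteq># R"
proof (rule mset_subset_eqI)
  fix p
  have "replicate_mset (count A p) p \<subseteq># A"
    by (simp add: count_le_replicate_mset_subset_eq[symmetric])
  then obtain C where C: "replicate_mset (count A p) p \<subseteq># C" "C \<subseteq># A" "size C = q"
    by (rule multiset_between) (use assms in auto)
  then have "replicate_mset (count A p) p \<subseteq># R"
    using assms(3) subset_mset.order_trans by blast
  then show "count A p \<le> count R p"
    by (simp add: count_le_replicate_mset_subset_eq[symmetric])
qed

text \<open>
  Having at least \<open>q\<close> of the \<open>n\<close> points in \<open>\<Omega>\<close> means containing some multiset of size \<open>q\<close> over \<open>\<Omega>\<close>.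
\<close>

lemma Union_stratum:
  assumes "q \<le> n"
  shows "(\<Union>s\<in>{q..n}. stratum \<Omega> s (n - s)) =
    point_roots n ` \<Union> (root_locus n ` multisets_of_size \<Omega> q)"
proof -
  have "R \<in> (\<Union>s\<in>{q..n}. stratum \<Omega> s (n - s)) \<longleftrightarrow>
      size R = n \<and> (\<exists>A\<in>multisets_of_size \<Omega> q. A \<subseteq># R)" for R
  proof -
    let ?in = "filter_mset (\<lambda>p. p \<in> \<Omega>) R" and ?out = "filter_mset (\<lambda>p. p \<notin> \<Omega>) R"
    have size: "size R = size ?in + size ?out"
      by (metis multiset_partition size_union)
    have "(\<exists>A\<in>multisets_of_size \<Omega> q. A \<subseteq># R) \<longleftrightarrow> q \<le> size ?in"
    proof
      assume "\<exists>A\<in>multisets_of_size \<Omega> q. A \<subseteq># R"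
      then obtain A where A: "set_mset A \<subseteq> \<Omega>" "size A = q" "A \<subseteq># R"
        by (auto simp: multisets_of_size_def)
      then have "filter_mset (\<lambda>p. p \<in> \<Omega>) A = A"
        by (auto simp: filter_mset_eq_conv)
      then have "A \<subseteq># ?in"
        using multiset_filter_mono[OF A(3), of "\<lambda>p. p \<in> \<Omega>"] by simp
      then show "q \<le> size ?in"
        using A(2) size_mset_mono by blast
    next
      assume "q \<le> size ?in"
      then obtain A where A: "A \<subseteq># ?in" "size A = q"
        using multiset_between[of "{#}" ?in q] by auto
      then have "A \<in> multisets_of_size \<Omega> q"
        using set_mset_mono[OF A(1)] by (auto simp: multisets_of_size_def)
      then show "\<exists>A\<in>multisets_of_size \<Omega> q. A \<subseteq># R"
        using A(1) multiset_filter_subset subset_mset.order_trans by blast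
    qed
    then show ?thesis
      using size assms by (auto simp: stratum_def)
  qed
  then show ?thesis
    by (auto simp: image_Union image_image point_roots_root_locus)
qed

text \<open>The multisets of size at most \<open>n\<close> over \<open>\<Omega>\<close> that are nonempty unions of multisets of size \<open>q\<close>.\<close>

definition bounded_multisets :: "'a set \<Rightarrow> nat \<Rightarrow> nat \<Rightarrow> 'a multiset set" where
  "bounded_multisets \<Omega> q n =
    {A. set_mset A \<subseteq> \<Omega> \<and> q \<le> size A \<and> size A \<le> n \<and> (\<forall>p. count A p \<le> q)}"

text \<open>
  The intersection is the locus of the union of \<open>\<A>\<close>; the size of this union is at most \<open>n\<close> because
  the intersection is nonempty.
\<close>

lemma Inter_root_locus_bounded:
  assumes "finite \<A>" "\<A> \<noteq> {}" "\<A> \<subseteq> multisets_of_size \<Omega> q"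
    and "\<Inter> (root_locus n ` \<A>) \<noteq> {}"
  shows "\<Inter> (root_locus n ` \<A>) \<in> root_locus n ` bounded_multisets \<Omega> q n"
  using assms
proof (induction \<A> rule: finite_ne_induct)
  case (singleton A)
  then have "A \<in> bounded_multisets \<Omega> q n"
    by (auto simp: bounded_multisets_def multisets_of_size_def root_locus_empty_iff not_less
        count_le_size)
  then show ?case by simp
next
  case (insert A \<A>)
  then obtain B where B: "B \<in> bounded_multisets \<Omega> q n"
      and eq: "\<Inter> (root_locus n ` \<A>) = root_locus n B"
    by auto
  have A: "set_mset A \<subseteq> \<Omega>" "size A = q"
    using insert.prems(1) by (auto simp: multisets_of_size_def)
  have Int: "\<Inter> (root_locus n ` insert A \<A>) = root_locus n (A \<union># B)"
    by (simp add: eq root_locus_Int)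
  have "size (A \<union># B) \<le> n"
    using insert.prems(2) unfolding Int root_locus_empty_iff by simp
  moreover have "q \<le> size (A \<union># B)"
    using A(2) size_mset_mono[of A "A \<union># B"] by simp
  moreover have "count A p \<le> q" for p
    using A(2) count_le_size[of A p] by simp
  ultimately have "A \<union># B \<in> bounded_multisets \<Omega> q n"
    using A B by (auto simp: bounded_multisets_def)
  with Int show ?case by blast
qed

text \<open>
  A bounded multiset of size at least \<open>q\<close> is the union of its submultisets of size \<open>q\<close>, so
  its locus is the intersection of theirs; the other inclusion is \<open>Inter_root_locus_bounded\<close>.
\<close>

lemma intersection_poset_root_locus:
  assumes "finite \<Omega>"
  shows "intersection_poset (root_locus n ` multisets_of_size \<Omega> q) =
    root_locus n ` bounded_multisets \<Omega> q n"
proof (intro equalityI subsetI)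
  fix X assume "X \<in> intersection_poset (root_locus n ` multisets_of_size \<Omega> q)"
  then obtain \<F> where \<F>: "\<F> \<subseteq> root_locus n ` multisets_of_size \<Omega> q" "\<F> \<noteq> {}" "\<Inter> \<F> \<noteq> {}"
      and X: "X = \<Inter> \<F>"
    unfolding intersection_poset_def by blast
  then obtain \<A> where \<A>: "\<A> \<subseteq> multisets_of_size \<Omega> q" "\<F> = root_locus n ` \<A>"
    by (auto simp: subset_image_iff)
  then have "finite \<A>"
    using assms finite_multisets_of_size finite_subset by blast
  then show "X \<in> root_locus n ` bounded_multisets \<Omega> q n"
    using Inter_root_locus_bounded[of \<A> \<Omega> q n] \<F> \<A> X by auto
next
  fix X assume "X \<in> root_locus n ` bounded_multisets \<Omega> q n"
  then obtain A where X: "X = root_locus n A" and A: "set_mset A \<subseteq> \<Omega>" "q \<le> size A" "size A \<le> n"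
      "\<And>p. count A p \<le> q"
    by (auto simp: bounded_multisets_def)
  let ?\<C> = "{C. C \<subseteq># A \<and> size C = q}"
  have "?\<C> \<noteq> {}"
    using multiset_between[of "{#}" A q] A(2) by auto
  moreover have "(\<forall>C\<in>?\<C>. C \<subseteq># R) \<longleftrightarrow> A \<subseteq># R" for R
    using submultisets_cover[of A q R] A by (auto intro: subset_mset.order_trans)
  ultimately have eq: "\<Inter> (root_locus n ` ?\<C>) = X"
    unfolding X Inter_root_locus[OF \<open>?\<C> \<noteq> {}\<close>] by (simp only: root_locus_def)
  have "X \<noteq> {}"
    using A(3) by (simp add: X root_locus_empty_iff)
  moreover have "?\<C> \<subseteq> multisets_of_size \<Omega> q"
    using A(1) by (auto simp: multisets_of_size_def dest: mset_subset_eqD)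
  ultimately show "X \<in> intersection_poset (root_locus n ` multisets_of_size \<Omega> q)"
    unfolding intersection_poset_def using eq \<open>?\<C> \<noteq> {}\<close> by blast
qed

lemma inj_on_root_locus: "inj_on (root_locus n) {A. size A \<le> n}"
  by (rule inj_onI) (metis mem_Collect_eq order_refl root_locus_subset_iff subset_mset.antisym)

lemma card_root_locus:
  assumes "finite \<Omega>" "q \<le> n"
  shows "card (root_locus n ` multisets_of_size \<Omega> q) = (card \<Omega> + q - 1) choose q"
proof -
  have "inj_on (root_locus n) (multisets_of_size \<Omega> q)"
    using assms(2) by (intro inj_on_subset[OF inj_on_root_locus]) (auto simp: multisets_of_size_def)
  then show ?thesis
    using assms(1) by (simp add: card_image card_multisets_of_size)
qed

text \<open>
  Vanishing at \<open>j\<close> distinct points is the same as having the multiset of these points, of size \<open>j\<close>,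
  among the roots: the locus has codimension \<open>j\<close> for \<open>j \<le> n\<close> and is empty for \<open>j = n + 1\<close>.
\<close>

lemma general_position_root_locus:
  assumes "1 \<le> n"
  shows "general_position n ((\<lambda>p. root_locus n {#p#}) ` \<Omega>)"
  unfolding general_position_def
proof (intro allI impI)
  fix \<F> assume "\<F> \<subseteq> (\<lambda>p. root_locus n {#p#}) ` \<Omega>" and fin: "finite \<F>"
  moreover have inj: "inj (\<lambda>p. root_locus n {#p#})"
    by (rule injI) (use assms inj_on_root_locus[of n] in \<open>auto dest: inj_onD\<close>)
  ultimately obtain S where \<F>: "\<F> = (\<lambda>p. root_locus n {#p#}) ` S"
    by (auto simp: subset_image_iff)
  have S: "finite S" "card \<F> = card S"
    using fin inj \<F> by (auto simp: finite_image_iff card_image inj_on_subset)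
  have Int: "\<Inter> \<F> = root_locus n (mset_set S)" if "S \<noteq> {}"
  proof -
    have "(\<forall>p\<in>S. p \<in># R) \<longleftrightarrow> mset_set S \<subseteq># R" for R
      using S(1) by (auto simp: subseteq_mset_def count_mset_set')
    then show ?thesis
      using that unfolding \<F> root_locus_def by auto
  qed
  show "(1 \<le> card \<F> \<and> card \<F> \<le> n \<longrightarrow> proj_subspace n (n - card \<F>) (\<Inter> \<F>)) \<and>
      (card \<F> = n + 1 \<longrightarrow> \<Inter> \<F> = {})"
  proof (intro conjI impI)
    assume "1 \<le> card \<F> \<and> card \<F> \<le> n"
    then show "proj_subspace n (n - card \<F>) (\<Inter> \<F>)"
      using proj_subspace_root_locus[of "mset_set S" n] Int S by fastforce
  next
    assume "card \<F> = n + 1"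
    then have "root_locus n (mset_set S) = {}" "S \<noteq> {}"
      using S by (auto simp: root_locus_empty_iff)
    then show "\<Inter> \<F> = {}"
      using Int by simp
  qed
qed

section \<open>Relabelling multisets along a bijection\<close>

text \<open>
  The remaining lemmas replace multisets of points of \<open>\<Omega>\<close> by multisets of labels. Labels are distinct
  only on \<open>{1..r}\<close>, so the order structure is preserved only for multisets over the set where the
  labelling is injective.
\<close>

lemma count_image_mset_inj_on:
  assumes "inj_on f S" "set_mset M \<subseteq> S" "x \<in> S"
  shows "count (image_mset f M) (f x) = count M x"
  using assms(2) by (induction M) (use assms(1,3) in \<open>auto dest: inj_onD\<close>)

lemma image_mset_sup_inj_on:
  assumes "inj_on f S" "set_mset M \<subseteq> S" "set_mset N \<subseteq> S"
  shows "image_mset f (M \<union># N) = image_mset f M \<union># image_mset f N"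
proof (rule multiset_eqI)
  fix y
  show "count (image_mset f (M \<union># N)) y = count (image_mset f M \<union># image_mset f N) y"
  proof (cases "y \<in> f ` S")
    case True
    then obtain x where "x \<in> S" "y = f x" by blast
    moreover have "set_mset (M \<union># N) \<subseteq> S"
      using assms by auto
    ultimately show ?thesis
      using assms by (simp only: count_image_mset_inj_on count_union_mset)
  next
    case False
    then have "y \<notin># image_mset f (M \<union># N)" "y \<notin># image_mset f M" "y \<notin># image_mset f N"
      using assms by auto
    then show ?thesis
      by (simp only: count_union_mset not_in_iff)
  qed
qed

lemma image_mset_subseteq_iff_inj_on:
  assumes "inj_on f S" "set_mset M \<subseteq> S" "set_mset N \<subseteq> S"
  shows "image_mset f M \<subseteq># image_mset f N \<longleftrightarrow> M \<subseteq># N"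
proof
  assume sub: "image_mset f M \<subseteq># image_mset f N"
  show "M \<subseteq># N"
  proof (rule mset_subset_eqI)
    fix x
    show "count M x \<le> count N x"
    proof (cases "x \<in> S")
      case True
      then show ?thesis
        using mset_subset_eq_count[OF sub, of "f x"] assms by (simp add: count_image_mset_inj_on)
    next
      case False
      then show ?thesis
        using assms(2) by (metis le0 not_in_iff subsetD)
    qed
  qed
qed (rule image_mset_subseteq_mono)

lemma bij_betw_image_mset:
  assumes "bij_betw f S T"
  shows "bij_betw (image_mset f) {M. set_mset M \<subseteq> S} {A. set_mset A \<subseteq> T}"
proof (rule bij_betw_byWitness[where f' = "image_mset (inv_into S f)"])
  show "\<forall>M\<in>{M. set_mset M \<subseteq> S}. image_mset (inv_into S f) (image_mset f M) = M"
  proof safe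
    fix M assume "set_mset M \<subseteq> S"
    then have "image_mset (\<lambda>x. inv_into S f (f x)) M = image_mset (\<lambda>x. x) M"
      using assms by (intro image_mset_cong) (auto simp: bij_betw_def inv_into_f_f)
    then show "image_mset (inv_into S f) (image_mset f M) = M"
      by (simp add: multiset.map_comp o_def)
  qed
  show "\<forall>A\<in>{A. set_mset A \<subseteq> T}. image_mset f (image_mset (inv_into S f) A) = A"
  proof safe
    fix A assume "set_mset A \<subseteq> T"
    then have "image_mset (\<lambda>y. f (inv_into S f y)) A = image_mset (\<lambda>y. y) A"
      using assms by (intro image_mset_cong) (auto simp: bij_betw_def f_inv_into_f)
    then show "image_mset f (image_mset (inv_into S f) A) = A"
      by (simp add: multiset.map_comp o_def)
  qed
  show "image_mset f ` {M. set_mset M \<subseteq> S} \<subseteq> {A. set_mset A \<subseteq> T}"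
    using bij_betw_imp_surj_on[OF assms] by (auto intro!: imageI)
  show "image_mset (inv_into S f) ` {A. set_mset A \<subseteq> T} \<subseteq> {M. set_mset M \<subseteq> S}"
    by (auto intro!: bij_betw_apply[OF bij_betw_inv_into[OF assms]])
qed

lemma bij_betw_image_mset_of_size:
  assumes "bij_betw f S T"
  shows "bij_betw (image_mset f) (multisets_of_size S q) (multisets_of_size T q)"
proof -
  have "bij_betw (image_mset f) {M \<in> {M. set_mset M \<subseteq> S}. size M = q}
      {A \<in> {A. set_mset A \<subseteq> T}. size A = q}"
    by (rule bij_betw_Collect[OF bij_betw_image_mset[OF assms]]) simp
  then show ?thesis
    by (simp add: multisets_of_size_def)
qed

lemma bij_betw_image_mset_bounded:
  assumes "bij_betw f S T"
  shows "bij_betw (image_mset f) (bounded_multisets S q n) (bounded_multisets T q n)"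
proof -
  have inj: "inj_on f S" and T: "T = f ` S"
    using assms by (auto simp: bij_betw_def)
  have cnt: "(\<forall>y. count (image_mset f M) y \<le> q) \<longleftrightarrow> (\<forall>x. count M x \<le> q)"
    if M: "set_mset M \<subseteq> S" for M
  proof -
    have "(\<forall>x. count M x \<le> q) \<longleftrightarrow> (\<forall>x\<in>S. count M x \<le> q)"
      using M by (metis le0 not_in_iff subsetD)
    also have "\<dots> \<longleftrightarrow> (\<forall>y\<in>T. count (image_mset f M) y \<le> q)"
      using inj M by (simp add: T count_image_mset_inj_on)
    also have "\<dots> \<longleftrightarrow> (\<forall>y. count (image_mset f M) y \<le> q)"
    proof -
      have "set_mset (image_mset f M) \<subseteq> T"
        using M T by auto
      then show ?thesis
        by (metis le0 not_in_iff subsetD)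
    qed
    finally show ?thesis ..
  qed
  have "bij_betw (image_mset f)
      {M \<in> {M. set_mset M \<subseteq> S}. q \<le> size M \<and> size M \<le> n \<and> (\<forall>x. count M x \<le> q)}
      {A \<in> {A. set_mset A \<subseteq> T}. q \<le> size A \<and> size A \<le> n \<and> (\<forall>y. count A y \<le> q)}"
    by (rule bij_betw_Collect[OF bij_betw_image_mset[OF assms]]) (simp add: cnt)
  then show ?thesis
    by (simp add: bounded_multisets_def)
qed

theorem proposition11:
  fixes \<Omega> :: "cp1 set" and r n :: nat
  assumes "finite \<Omega>" and "card \<Omega> = r" and "1 \<le> n"
  shows "(\<exists>\<H>. finite \<H> \<and> card \<H> = r \<and> (\<forall>H\<in>\<H>. proj_hyperplane n H) \<and> general_position n \<H> \<and>
            (\<Union>i\<in>{1..n}. stratum \<Omega> i (n - i)) = point_roots n ` (\<Union>\<H>)) \<and>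
         (\<forall>q\<in>{1..n}. \<exists>\<A>. finite \<A> \<and> card \<A> = (r + q - 1) choose q \<and>
            (\<forall>X\<in>\<A>. proj_subspace n (n - q) X) \<and>
            (\<Union>s\<in>{q..n}. stratum \<Omega> s (n - s)) = point_roots n ` (\<Union>\<A>) \<and>
            (\<exists>L :: nat multiset \<Rightarrow> complex poly set set.
               bij_betw L {M \<in> multisubsets r q n. \<forall>k. count M k \<le> q} (intersection_poset \<A>) \<and>
               bij_betw L {M \<in> multisubsets r q n. size M = q} \<A> \<and>
               (\<forall>M\<in>multisubsets r q n. \<forall>N\<in>multisubsets r q n. L N \<subseteq> L M \<longleftrightarrow> M \<subseteq># N) \<and>
               (\<forall>M\<in>multisubsets r q n. \<forall>N\<in>multisubsets r q n.
                  L M \<inter> L N = (if size (M \<union># N) \<le> n then L (M \<union># N) else {})) \<and>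
               (\<forall>M\<in>multisubsets r q n. proj_subspace n (n - size M) (L M))))"
proof (intro conjI ballI)
  let ?\<H> = "(\<lambda>p. root_locus n {#p#}) ` \<Omega>"
  have singletons: "multisets_of_size \<Omega> 1 = (\<lambda>p. {#p#}) ` \<Omega>"
    by (auto simp: multisets_of_size_def image_iff dest!: size_1_singleton_mset[unfolded One_nat_def])
  have \<H>: "?\<H> = root_locus n ` multisets_of_size \<Omega> 1"
    unfolding singletons image_image ..
  have "card ?\<H> = r"
    using card_root_locus[of \<Omega> 1 n] assms by (simp add: \<H>)
  moreover have "\<forall>H\<in>?\<H>. proj_hyperplane n H"
    using proj_subspace_root_locus[of "{#p#}" n for p] assms(3) by (simp add: proj_hyperplane_def)
  moreover have "(\<Union>i\<in>{1..n}. stratum \<Omega> i (n - i)) = point_roots n ` (\<Union> ?\<H>)"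
    unfolding \<H> using assms(3) by (rule Union_stratum)
  ultimately show "\<exists>\<H>. finite \<H> \<and> card \<H> = r \<and> (\<forall>H\<in>\<H>. proj_hyperplane n H) \<and>
      general_position n \<H> \<and> (\<Union>i\<in>{1..n}. stratum \<Omega> i (n - i)) = point_roots n ` (\<Union>\<H>)"
    using assms(1) general_position_root_locus[OF assms(3), of \<Omega>]
    by (intro exI[of _ ?\<H>]) simp
next
  fix q assume "q \<in> {1..n}"
  then have q: "q \<le> n" by simp
  obtain e where e: "bij_betw e {1..r} \<Omega>"
    using ex_bij_betw_nat_finite_1[OF assms(1)] assms(2) by auto
  then have inj: "inj_on e {1..r}"
    by (simp add: bij_betw_def)
  define L where "L M = root_locus n (image_mset e M)" for M
  have L: "L = root_locus n \<circ> image_mset e"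
    by (simp add: L_def fun_eq_iff)
  let ?\<A> = "root_locus n ` multisets_of_size \<Omega> q"
  have dom1: "{M \<in> multisubsets r q n. size M = q} = multisets_of_size {1..r} q"
    using q by (auto simp: multisubsets_def multisets_of_size_def)
  have dom2: "{M \<in> multisubsets r q n. \<forall>k. count M k \<le> q} = bounded_multisets {1..r} q n"
    by (auto simp: multisubsets_def bounded_multisets_def)
  have "bij_betw (root_locus n) (multisets_of_size \<Omega> q) ?\<A>"
    using q by (intro inj_on_imp_bij_betw inj_on_subset[OF inj_on_root_locus])
      (auto simp: multisets_of_size_def)
  then have bij1: "bij_betw L {M \<in> multisubsets r q n. size M = q} ?\<A>"
    unfolding L dom1 by (rule bij_betw_trans[OF bij_betw_image_mset_of_size[OF e]])
  have "bij_betw (root_locus n) (bounded_multisets \<Omega> q n) (intersection_poset ?\<A>)"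
    unfolding intersection_poset_root_locus[OF assms(1)]
    by (intro inj_on_imp_bij_betw inj_on_subset[OF inj_on_root_locus])
      (auto simp: bounded_multisets_def)
  then have bij2: "bij_betw L {M \<in> multisubsets r q n. \<forall>k. count M k \<le> q} (intersection_poset ?\<A>)"
    unfolding L dom2 by (rule bij_betw_trans[OF bij_betw_image_mset_bounded[OF e]])
  have order: "L N \<subseteq> L M \<longleftrightarrow> M \<subseteq># N" if "M \<in> multisubsets r q n" "N \<in> multisubsets r q n" for M N
    using that inj unfolding L_def multisubsets_def
    by (simp add: root_locus_subset_iff image_mset_subseteq_iff_inj_on[of e "{1..r}"])
  have Int: "L M \<inter> L N = (if size (M \<union># N) \<le> n then L (M \<union># N) else {})"
    if "M \<in> multisubsets r q n" "N \<in> multisubsets r q n" for M N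
  proof -
    have "image_mset e (M \<union># N) = image_mset e M \<union># image_mset e N"
      using that by (intro image_mset_sup_inj_on[OF inj]) (auto simp: multisubsets_def)
    then have "L M \<inter> L N = L (M \<union># N)"
      by (simp add: L_def root_locus_Int)
    moreover have "L (M \<union># N) = {}" if "\<not> size (M \<union># N) \<le> n"
      using that unfolding L_def root_locus_empty_iff by simp
    ultimately show ?thesis by simp
  qed
  have dim: "proj_subspace n (n - size M) (L M)" if "M \<in> multisubsets r q n" for M
    using proj_subspace_root_locus[of "image_mset e M" n] that by (simp add: L_def multisubsets_def)
  have dim_q: "proj_subspace n (n - q) X" if "X \<in> ?\<A>" for X
    using proj_subspace_root_locus[of _ n] q that by (auto simp: multisets_of_size_def)
  have "finite ?\<A>"
    using assms(1) by (intro finite_imageI finite_multisets_of_size)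
  moreover have "card ?\<A> = (r + q - 1) choose q"
    using card_root_locus[OF assms(1) q] assms(2) by simp
  moreover note Union_stratum[OF q, of \<Omega>]
  ultimately show "\<exists>\<A>. finite \<A> \<and> card \<A> = (r + q - 1) choose q \<and>
            (\<forall>X\<in>\<A>. proj_subspace n (n - q) X) \<and>
            (\<Union>s\<in>{q..n}. stratum \<Omega> s (n - s)) = point_roots n ` (\<Union>\<A>) \<and>
            (\<exists>L :: nat multiset \<Rightarrow> complex poly set set.
               bij_betw L {M \<in> multisubsets r q n. \<forall>k. count M k \<le> q} (intersection_poset \<A>) \<and>
               bij_betw L {M \<in> multisubsets r q n. size M = q} \<A> \<and>
               (\<forall>M\<in>multisubsets r q n. \<forall>N\<in>multisubsets r q n. L N \<subseteq> L M \<longleftrightarrow> M \<subseteq># N) \<and>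
               (\<forall>M\<in>multisubsets r q n. \<forall>N\<in>multisubsets r q n.
                  L M \<inter> L N = (if size (M \<union># N) \<le> n then L (M \<union># N) else {})) \<and>
               (\<forall>M\<in>multisubsets r q n. proj_subspace n (n - size M) (L M)))"
    using bij1 bij2
    by (intro exI[of _ ?\<A>] conjI exI[of _ L] ballI)
      (assumption | erule (1) order Int | erule dim_q dim)+
qed

end
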